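(* Let $\mathcal{P}$ and $\mathcal{Q}$ be admissible degree-$d$ portraits on $n$ points and suppose that either (1) $d = 2$ and there is at least one pair $i, j \in [n]$ of distinct elements such that $\mathcal{P}(i) = \mathcal{P}(j)$ and $\mathcal{Q}(i) = \mathcal{Q}(j)$, (2) $d = 3$ and there are at least two pairs $i, j \in [n]$ of distinct elements such that $\mathcal{P}(i) = \mathcal{P}(j)$ and $\mathcal{Q}(i) = \mathcal{Q}(j)$, or (3) $d$ is arbitrary and the fiber partitions $\Pi_{\mathcal{P}}$, $\Pi_{\mathcal{Q}}$ have a common fiber with $d$ elements. If $q$ is a degree-at-most-$d$ realization of both $\mathcal{P}$ and $\mathcal{Q}$ via the polynomials $f$ and $g$, respectively, then $f$ and $g$ are left associates.
   Context: The base field $K$ is arbitrary. $[n]:=\{1,\ldots,n\}$; a portrait on $n$ points is a function $\mathcal{P}:[n]\to[n]$, and its fiber partition is $\Pi_{\mathcal{P}}:=\{\mathcal{P}^{-1}(i): i\in\mathcal{P}([n])\}$, whose members are called fibers. For $d\ge 2$, a portrait $\mathcal{P}$ is an admissible degree-$d$ portrait if every element of $[n]$ has at most $d$ preimages under $\mathcal{P}$ and, for every integer $k\geq 1$, $\mathcal{P}$ has at most $\frac{1}{k}\sum_{j\mid k}\mu(k/j)d^j$ periodic cycles of length $k$ (with $\mu$ the Möbius function). A tuple $q=(q_1,\ldots,q_n)$ of pairwise distinct points of the affine line is a degree-at-most-$d$ realization of $\mathcal{P}$ via the polynomial $f$ if $\deg f\leq d$ and $f(q_i)=q_{\mathcal{P}(i)}$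 for all $i\in[n]$. Polynomials $f,g$ are left associates if there is a linear polynomial $\ell(x)=ax+b$ with $a\neq 0$ such that $f(x)=\ell(g(x))$.
   Formalization: Added: if n = d, then f is constant if and only if g is constant; without it the claim fails, e.g. d = n = 2, P = Q constantly 1, f = q_1, g = q_1 + (x - q_1)(x - q_2). *)

theory Defs
  imports
    "HOL-Computational_Algebra.Computational_Algebra"
    "HOL-Combinatorics.Orbits"
begin

text \<open>
  The point set is \<open>{1..n}\<close>. A portrait is a function on \<^typ>\<open>nat\<close> that maps \<open>{1..n}\<close> to itself;
  its values outside \<open>{1..n}\<close> are arbitrary, and every notion below ignores them.
\<close>

definition portrait :: "nat \<Rightarrow> (nat \<Rightarrow> nat) \<Rightarrow> bool" where
  "portrait n P \<longleftrightarrow> P \<in> {1..n} \<rightarrow> {1..n}"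

definition portrait_fiber :: "nat \<Rightarrow> (nat \<Rightarrow> nat) \<Rightarrow> nat \<Rightarrow> nat set" where
  "portrait_fiber n P i = {j \<in> {1..n}. P j = i}"

definition fiber_partition :: "nat \<Rightarrow> (nat \<Rightarrow> nat) \<Rightarrow> nat set set" where
  "fiber_partition n P = portrait_fiber n P ` (P ` {1..n})"

text \<open>
  A periodic cycle is represented by its set of points; \<^const>\<open>cyclic_on\<close> says that this set is
  the forward orbit of one of its own points.
\<close>

definition periodic_cycles :: "nat \<Rightarrow> (nat \<Rightarrow> nat) \<Rightarrow> nat \<Rightarrow> nat set set" where
  "periodic_cycles n P k = {S. S \<subseteq> {1..n} \<and> cyclic_on P S \<and> card S = k}"

definition moebius_mu :: "nat \<Rightarrow> int" where
  "moebius_mu m = (if squarefree m then (- 1) ^ card (prime_factors m) else 0)"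

definition admissible_portrait :: "nat \<Rightarrow> nat \<Rightarrow> (nat \<Rightarrow> nat) \<Rightarrow> bool" where
  "admissible_portrait d n P \<longleftrightarrow>
     portrait n P \<and>
     (\<forall>i\<in>{1..n}. card (portrait_fiber n P i) \<le> d) \<and>
     (\<forall>k\<ge>1. real (card (periodic_cycles n P k))
              \<le> 1 / real k * (\<Sum>j | j dvd k. real_of_int (moebius_mu (k div j)) * real d ^ j))"

text \<open>
  As in the source, the degree of \<open>f\<close> is only bounded above: constant polynomials, including
  \<open>0\<close>, are allowed. When \<open>n = d\<close> and \<open>P\<close> is constant, \<open>P\<close> has both constant and
  nonconstant realizations at the same \<open>q\<close>, and these are not left associates.
\<close>

definition realization ::
    "nat \<Rightarrow> nat \<Rightarrow> (nat \<Rightarrow> nat) \<Rightarrow> (nat \<Rightarrow> 'a) \<Rightarrow> 'a::field poly \<Rightarrow> bool" where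
  "realization d n P q f \<longleftrightarrow>
     inj_on q {1..n} \<and> degree f \<le> d \<and> (\<forall>i\<in>{1..n}. poly f (q i) = q (P i))"

text \<open>
  Associates as formal polynomials, not merely as functions on the (possibly finite) field.
\<close>

definition left_associates :: "'a::field poly \<Rightarrow> 'a poly \<Rightarrow> bool" where
  "left_associates f g \<longleftrightarrow> (\<exists>a b. a \<noteq> 0 \<and> f = pcompose [:b, a:] g)"

text \<open>
  Pairs are unordered: \<open>(i, j)\<close> and \<open>(j, i)\<close> count as one pair.
\<close>

definition common_pairs :: "nat \<Rightarrow> (nat \<Rightarrow> nat) \<Rightarrow> (nat \<Rightarrow> nat) \<Rightarrow> nat set set" where
  "common_pairs n P Q =
     {{i, j} | i j. i \<in> {1..n} \<and> j \<in> {1..n} \<and> i \<noteq> j \<and> P i = P j \<and> Q i = Q j}"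

end

theory Submission
  imports Defs
begin

text \<open>
  The theorem rests on one fact about roots: a polynomial that takes a single value at more points
  than its degree is constant. To prove that \<open>f\<close> and \<open>g\<close> are left associates it is therefore
  enough to find nonzero scalars \<open>s\<close>, \<open>t\<close> such that \<open>s f - t g\<close> takes a single value at more points
  than its degree; this difference is then constant and can be solved for \<open>f\<close>.

  Suppose first that \<open>P\<close> and \<open>Q\<close> share a fiber \<open>F\<close> with \<open>d\<close> elements. Both polynomials are constant
  on the \<open>d\<close> points \<open>q ` F\<close>, and the scalars are chosen to cancel the terms of degree \<open>d\<close>. They are
  nonzero unless one of the polynomials is constant. A constant realization means that \<open>F\<close> is all
  of \<open>{1..n}\<close>, so \<open>n = d\<close>, and in that situation the two polynomials are assumed to be
  constant together (lemma \<open>left_associates_if_common_full_fiber\<close>).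

  The bound on the size of fibers reduces the conditions on pairs to this situation, apart from one
  case: a common pair for \<open>d = 2\<close> fills a fiber, and so do two overlapping common pairs for
  \<open>d = 3\<close>. In the remaining case, two disjoint common pairs \<open>{i, j}\<close> and \<open>{k, l}\<close> for \<open>d = 3\<close>, the
  scalars are chosen such that the values of \<open>s f - t g\<close> on the two pairs agree. This gives one
  value at four points, which is too many for degree three. Here the scalars are nonzero because
  the two pairs cannot lie in one fiber, which would have four elements
  (lemma \<open>left_associates_if_two_disjoint_pairs\<close>).
\<close>

section \<open>Polynomials that take one value often\<close>

lemma degree_0_if_constant_on:
  fixes p :: "'a::field poly"
  assumes "degree p < card A" and "\<And>x. x \<in> A \<Longrightarrow> poly p x = c"
  shows "degree p = 0"
proof -
  have "p = [:c:]"
    by (rule poly_eqI_degree[where A = A]) (use assms in auto)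
  then show ?thesis by simp
qed

lemma left_associates_if_combination_constant:
  fixes f g :: "'a::field poly"
  assumes "s \<noteq> 0" and "t \<noteq> 0" and "degree (smult s f - smult t g) = 0"
  shows "left_associates f g"
proof -
  obtain c where c: "smult s f - smult t g = [:c:]"
    using assms(3) by (metis degree_eq_zeroE)
  have "f = smult (1 / s) (smult s f)"
    using assms(1) by simp
  also have "smult s f = smult t g + [:c:]"
    using c by (simp add: algebra_simps)
  finally have "f = pcompose [:c / s, t / s:] g"
    by (simp add: pcompose_pCons smult_add_right add.commute)
  then show ?thesis
    unfolding left_associates_def using assms(1,2) by (metis divide_eq_0_iff)
qed

lemma left_associates_constants:
  fixes f g :: "'a::field poly"
  assumes "degree f = 0" and "degree g = 0"
  shows "left_associates f g"
  by (rule left_associates_if_combination_constant[where s = 1 and t = 1])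
    (use degree_diff_le_max[of f g] assms in simp_all)

text \<open>
  The space of polynomials of degree at most \<open>d\<close> that are constant on \<open>d\<close> given points is spanned by
  \<open>1\<close> and the monic polynomial of degree \<open>d\<close> that vanishes there. Nonconstant members therefore have
  a nonzero coefficient in degree \<open>d\<close>, and cross-multiplying by these coefficients lowers the degree.
\<close>

lemma left_associates_if_constant_on:
  fixes f g :: "'a::field poly"
  assumes deg: "degree f \<le> card A" "degree g \<le> card A"
    and nonconst: "degree f \<noteq> 0" "degree g \<noteq> 0"
    and f: "\<And>x. x \<in> A \<Longrightarrow> poly f x = a" and g: "\<And>x. x \<in> A \<Longrightarrow> poly g x = b"
  shows "left_associates f g"
proof -
  let ?d = "card A"
  have df: "degree f = ?d"
    using degree_0_if_constant_on[of f A a, OF _ f] deg(1) nonconst(1) by fastforce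
  have dg: "degree g = ?d"
    using degree_0_if_constant_on[of g A b, OF _ g] deg(2) nonconst(2) by fastforce
  let ?s = "coeff g ?d" and ?t = "coeff f ?d"
  let ?h = "smult ?s f - smult ?t g"
  have st: "?s \<noteq> 0" "?t \<noteq> 0"
    using df dg nonconst by (metis degree_0 leading_coeff_0_iff)+
  have "degree ?h \<le> ?d"
    by (intro degree_diff_le order.trans[OF degree_smult_le] deg)
  moreover have "coeff ?h ?d = 0"
    by simp
  ultimately have "degree ?h < ?d"
    using df nonconst by (metis degree_0 leading_coeff_0_iff le_neq_implies_less not_gr_zero)
  then have "degree ?h = 0"
    by (rule degree_0_if_constant_on[where c = "?s * a - ?t * b"]) (simp add: f g)
  then show ?thesis
    using left_associates_if_combination_constant st by blast
qed

text \<open>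
  The scalars are the increments of \<open>g\<close> and of \<open>f\<close> from one pair to the other, so the increment of the
  difference vanishes.
\<close>

lemma left_associates_if_two_disjoint_pairs:
  fixes f g :: "'a::field poly"
  assumes deg: "degree f \<le> 3" "degree g \<le> 3"
    and card: "card {x, y, z, w} = 4"
    and f: "poly f x = poly f y" "poly f z = poly f w" "poly f x \<noteq> poly f z"
    and g: "poly g x = poly g y" "poly g z = poly g w" "poly g x \<noteq> poly g z"
  shows "left_associates f g"
proof -
  let ?s = "poly g x - poly g z" and ?t = "poly f x - poly f z"
  let ?h = "smult ?s f - smult ?t g"
  have "degree ?h \<le> 3"
    by (intro degree_diff_le order.trans[OF degree_smult_le] deg)
  then have "degree ?h < card {x, y, z, w}"
    using card by simp
  moreover have "poly ?h v = poly ?h x" if "v \<in> {x, y, z, w}" for v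
  proof -
    have "poly ?h z = poly ?h x"
      by (simp add: algebra_simps)
    then show ?thesis
      using that f(1,2) g(1,2) by auto
  qed
  ultimately have "degree ?h = 0"
    by (rule degree_0_if_constant_on)
  then show ?thesis
    using f(3) g(3) by (intro left_associates_if_combination_constant) auto
qed

section \<open>Common fibers of portraits\<close>

lemma admissible_card_le:
  assumes "admissible_portrait d n P" and "A \<subseteq> {1..n}" and "\<And>i. i \<in> A \<Longrightarrow> P i = c"
  shows "card A \<le> d"
proof (cases "A = {}")
  case False
  then obtain i where i: "i \<in> A" by blast
  have "c \<in> {1..n}"
    using assms i unfolding admissible_portrait_def portrait_def by blast
  then have "card (portrait_fiber n P c) \<le> d"
    using assms(1) unfolding admissible_portrait_def by blast
  moreover have "card A \<le> card (portrait_fiber n P c)"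
    by (rule card_mono) (use assms in \<open>auto simp: portrait_fiber_def\<close>)
  ultimately show ?thesis by linarith
qed simp

text \<open>A set of \<open>d\<close> points with the same image cannot be enlarged, so it is a whole fiber.\<close>

lemma full_set_in_fiber_partition:
  assumes adm: "admissible_portrait d n P" and A: "A \<subseteq> {1..n}" "card A = d" "d \<ge> 1"
    and const: "\<And>i. i \<in> A \<Longrightarrow> P i = c"
  shows "A \<in> fiber_partition n P"
proof -
  obtain i where i: "i \<in> A"
    using A(2,3) by fastforce
  have "A = portrait_fiber n P c"
  proof (rule card_seteq)
    show "finite (portrait_fiber n P c)"
      by (simp add: portrait_fiber_def)
    show "A \<subseteq> portrait_fiber n P c"
      using A(1) const by (auto simp: portrait_fiber_def)
    have "card (portrait_fiber n P c) \<le> d"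
      by (rule admissible_card_le[OF adm, where c = c]) (auto simp: portrait_fiber_def)
    then show "card (portrait_fiber n P c) \<le> card A"
      using A(2) by simp
  qed
  moreover have "c \<in> P ` {1..n}"
    using i A(1) const by blast
  ultimately show ?thesis
    unfolding fiber_partition_def by blast
qed

text \<open>
  A constant realization forces the portrait to be constant, because the points \<open>q i\<close> are distinct;
  its only fiber is then the whole point set.
\<close>

lemma fiber_eq_if_constant_realization:
  assumes "portrait n P" and "realization d n P q f" and "degree f = 0"
    and "F \<in> fiber_partition n P"
  shows "F = {1..n}"
proof -
  obtain i where i: "i \<in> {1..n}" and F: "F = portrait_fiber n P (P i)"
    using assms(4) unfolding fiber_partition_def by blast
  obtain v where v: "f = [:v:]"
    using assms(3) by (metis degree_eq_zeroE)
  have "P j = P i" if j: "j \<in> {1..n}" for j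
  proof -
    have "q (P j) = q (P i)"
      using assms(2) i j v unfolding realization_def by (metis poly_const_conv)
    moreover have "P j \<in> {1..n}" "P i \<in> {1..n}"
      using assms(1) i j unfolding portrait_def by blast+
    ultimately show ?thesis
      using assms(2) unfolding realization_def inj_on_def by blast
  qed
  then show ?thesis
    using F by (auto simp: portrait_fiber_def)
qed

lemma realization_constant_on_fiber:
  assumes "realization d n P q f" and "F \<in> fiber_partition n P"
  shows "\<exists>c. \<forall>x \<in> q ` F. poly f x = c"
  using assms unfolding realization_def fiber_partition_def portrait_fiber_def by auto

lemma left_associates_if_common_full_fiber:
  fixes f g :: "'a::field poly"
  assumes P: "portrait n P" and Q: "portrait n Q"
    and f: "realization d n P q f" and g: "realization d n Q q g"
    and F: "F \<in> fiber_partition n P" "F \<in> fiber_partition n Q" "card F = d"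
    and nondegenerate: "n = d \<longrightarrow> (degree f = 0 \<longleftrightarrow> degree g = 0)"
  shows "left_associates f g"
proof (cases "degree f = 0 \<or> degree g = 0")
  case True
  then have "F = {1..n}"
    using fiber_eq_if_constant_realization P Q f g F(1,2) by blast
  then have "n = d"
    using F(3) by simp
  then show ?thesis
    using True nondegenerate by (auto intro: left_associates_constants)
next
  case False
  obtain a where a: "\<forall>x \<in> q ` F. poly f x = a"
    using realization_constant_on_fiber f F(1) by blast
  obtain b where b: "\<forall>x \<in> q ` F. poly g x = b"
    using realization_constant_on_fiber g F(2) by blast
  have "F \<subseteq> {1..n}"
    using F(1) unfolding fiber_partition_def portrait_fiber_def by auto
  then have "card (q ` F) = d"
    using f F(3) unfolding realization_def by (metis card_image inj_on_subset)
  then show ?thesis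
    using False a b f g
    by (intro left_associates_if_constant_on[of f "q ` F" g a b]) (auto simp: realization_def)
qed

lemma common_pairsE:
  assumes "e \<in> common_pairs n P Q"
  obtains c c' where "e \<subseteq> {1..n}" "card e = 2" "\<forall>i\<in>e. P i = c" "\<forall>i\<in>e. Q i = c'"
  using assms that unfolding common_pairs_def by fastforce

text \<open>
  Two distinct overlapping pairs have a union of three points, which fills a fiber of both
  portraits; two disjoint pairs in one fiber would make a fiber of four points.
\<close>

lemma two_common_pairs_cases:
  assumes P: "admissible_portrait 3 n P" and Q: "admissible_portrait 3 n Q"
    and "card (common_pairs n P Q) \<ge> 2"
  obtains (fiber) F where "F \<in> fiber_partition n P \<inter> fiber_partition n Q" "card F = 3"
  | (disjoint) i j k l where "{i, j, k, l} \<subseteq> {1..n}" "card {i, j, k, l} = 4"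
      "P i = P j" "P k = P l" "P i \<noteq> P k" "Q i = Q j" "Q k = Q l" "Q i \<noteq> Q k"
proof -
  obtain T where T: "T \<subseteq> common_pairs n P Q" "card T = 2"
    using assms(3) by (meson obtain_subset_with_card_n)
  then obtain e e' where e: "e \<in> common_pairs n P Q" "e' \<in> common_pairs n P Q" "e \<noteq> e'"
    by (auto simp: card_2_iff)
  obtain a b where ab: "e \<subseteq> {1..n}" "card e = 2" "\<forall>i\<in>e. P i = a" "\<forall>i\<in>e. Q i = b"
    using e(1) by (rule common_pairsE)
  obtain a' b' where ab': "e' \<subseteq> {1..n}" "card e' = 2" "\<forall>i\<in>e'. P i = a'" "\<forall>i\<in>e'. Q i = b'"
    using e(2) by (rule common_pairsE)
  obtain i j where ij: "e = {i, j}" "i \<noteq> j"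
    using ab(2) by (metis card_2_iff)
  obtain k l where kl: "e' = {k, l}" "k \<noteq> l"
    using ab'(2) by (metis card_2_iff)
  show thesis
  proof (cases "e \<inter> e' = {}")
    case False
    have card3: "card (e \<union> e') = 3"
      using False ij kl e(3) by (auto simp: card_insert_if)
    have sub: "e \<union> e' \<subseteq> {1..n}"
      using ab(1) ab'(1) by blast
    have "e \<union> e' \<in> fiber_partition n P"
      by (rule full_set_in_fiber_partition[OF P sub card3, where c = a])
        (use False ab(3) ab'(3) in auto)
    moreover have "e \<union> e' \<in> fiber_partition n Q"
      by (rule full_set_in_fiber_partition[OF Q sub card3, where c = b])
        (use False ab(4) ab'(4) in auto)
    ultimately show thesis
      using card3 fiber by blast
  next
    case True
    have sub: "{i, j, k, l} \<subseteq> {1..n}"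
      using ab(1) ab'(1) ij kl by blast
    have card4: "card {i, j, k, l} = 4"
      using True ij kl by auto
    have vals: "P i = a" "P j = a" "P k = a'" "P l = a'" "Q i = b" "Q j = b" "Q k = b'" "Q l = b'"
      using ab(3,4) ab'(3,4) ij kl by auto
    have "a \<noteq> a'"
    proof
      assume "a = a'"
      then have "card {i, j, k, l} \<le> 3"
        using vals by (intro admissible_card_le[OF P sub, of a]) auto
      then show False
        using card4 by linarith
    qed
    moreover have "b \<noteq> b'"
    proof
      assume "b = b'"
      then have "card {i, j, k, l} \<le> 3"
        using vals by (intro admissible_card_le[OF Q sub, of b]) auto
      then show False
        using card4 by linarith
    qed
    ultimately show thesis
      using disjoint[OF sub card4] vals by simp
  qed
qed

section \<open>Left associates from common pairs and fibers\<close>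

theorem theorem1p7:
  fixes d n :: nat
    and P Q :: "nat \<Rightarrow> nat"
    and q :: "nat \<Rightarrow> 'a::field"
    and f g :: "'a poly"
  assumes "d \<ge> 2"
    and "admissible_portrait d n P" and "admissible_portrait d n Q"
    and "d = 2 \<and> card (common_pairs n P Q) \<ge> 1
       \<or> d = 3 \<and> card (common_pairs n P Q) \<ge> 2
       \<or> (\<exists>F \<in> fiber_partition n P \<inter> fiber_partition n Q. card F = d)"
    and "realization d n P q f" and "realization d n Q q g"
    and nondegenerate: "n = d \<longrightarrow> (degree f = 0 \<longleftrightarrow> degree g = 0)"
  shows "left_associates f g"
proof -
  have P: "portrait n P" and Q: "portrait n Q"
    using assms(2,3) unfolding admissible_portrait_def by blast+
  have full: "left_associates f g"
    if "F \<in> fiber_partition n P \<inter> fiber_partition n Q" "card F = d" for F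
    using left_associates_if_common_full_fiber[OF P Q assms(5,6) _ _ _ nondegenerate] that by blast
  from assms(4) show ?thesis
  proof (elim disjE conjE bexE)
    assume d: "d = 2" and "card (common_pairs n P Q) \<ge> 1"
    then obtain e where "e \<in> common_pairs n P Q"
      by fastforce
    then obtain c c' where e: "e \<subseteq> {1..n}" "card e = 2" "\<forall>i\<in>e. P i = c" "\<forall>i\<in>e. Q i = c'"
      by (rule common_pairsE)
    have "e \<in> fiber_partition n P" "e \<in> fiber_partition n Q"
      using full_set_in_fiber_partition[of d n _ e] assms(2,3) e d by auto
    then show ?thesis
      using full e(2) d by blast
  next
    assume d: "d = 3" and pairs: "card (common_pairs n P Q) \<ge> 2"
    from assms(2,3) pairs show ?thesis
      unfolding d
    proof (cases rule: two_common_pairs_cases)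
      case (fiber F)
      then show ?thesis
        using full d by blast
    next
      case (disjoint i j k l)
      have inj: "inj_on q {1..n}"
        using assms(5) unfolding realization_def by blast
      have card: "card {q i, q j, q k, q l} = 4"
        using card_image[OF inj_on_subset[OF inj disjoint(1)]] disjoint(2) by simp
      have f: "degree f \<le> 3" "\<And>m. m \<in> {i, j, k, l} \<Longrightarrow> poly f (q m) = q (P m)"
        and g: "degree g \<le> 3" "\<And>m. m \<in> {i, j, k, l} \<Longrightarrow> poly g (q m) = q (Q m)"
        using assms(5,6) d disjoint(1) unfolding realization_def by blast+
      have "P i \<in> {1..n}" "P k \<in> {1..n}" "Q i \<in> {1..n}" "Q k \<in> {1..n}"
        using P Q disjoint(1) unfolding portrait_def by auto
      then have "q (P i) \<noteq> q (P k)" "q (Q i) \<noteq> q (Q k)"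
        using inj disjoint(5,8) unfolding inj_on_def by blast+
      then show ?thesis
        using left_associates_if_two_disjoint_pairs[OF f(1) g(1) card] f(2) g(2) disjoint(3,4,6,7)
        by simp
    qed
  next
    fix F
    assume "F \<in> fiber_partition n P \<inter> fiber_partition n Q" "card F = d"
    then show ?thesis
      by (rule full)
  qed
qed

end
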